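(* Let $G$ be any group (not necessarily abelian). Then $G$ has the matching property if and only if $G$ is torsion-free or cyclic of prime order.
   Context: Groups are written multiplicatively with identity element $1$. Given nonempty finite subsets $A, B$ of a group $G$, a matching from $A$ to $B$ is a bijective map $\varphi : A \rightarrow B$ such that $a\varphi(a) \notin A$ for all $a \in A$. The group $G$ has the matching property if, for all nonempty finite subsets $A, B$ of $G$ with $|A| = |B|$ and $1 \notin B$, there exists a matching from $A$ to $B$. A group is torsion-free if its only element of finite order is $1$; in particular, the trivial group is torsion-free (and vacuously satisfies the matching property). *)

theory Defs
  imports "HOL-Algebra.Algebra"
begin

definition is_matching ::
  "('a, 'b) monoid_scheme \<Rightarrow> 'a set \<Rightarrow> 'a set \<Rightarrow> ('a \<Rightarrow> 'a) \<Rightarrow> bool" where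
  "is_matching G A B \<phi> \<longleftrightarrow>
     bij_betw \<phi> A B \<and> (\<forall>a\<in>A. a \<otimes>\<^bsub>G\<^esub> \<phi> a \<notin> A)"

definition matching_property :: "('a, 'b) monoid_scheme \<Rightarrow> bool" where
  "matching_property G \<longleftrightarrow>
     (\<forall>A B. A \<subseteq> carrier G \<and> B \<subseteq> carrier G \<and> finite A \<and> finite B \<and>
            A \<noteq> {} \<and> B \<noteq> {} \<and> card A = card B \<and> \<one>\<^bsub>G\<^esub> \<notin> B \<longrightarrow>
            (\<exists>\<phi>. is_matching G A B \<phi>))"

(* group.ord is 0 exactly on the elements of infinite order (group.ord_eq_0). *)
definition torsion_free_group :: "('a, 'b) monoid_scheme \<Rightarrow> bool" where
  "torsion_free_group G \<longleftrightarrow>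
     (\<forall>x\<in>carrier G. group.ord G x \<noteq> 0 \<longrightarrow> x = \<one>\<^bsub>G\<^esub>)"

end

theory Submission
  imports Defs
begin

text \<open>
  A matching from \<open>A\<close> to \<open>B\<close> is a system of distinct representatives for the sets
  \<open>{b \<in> B. a \<otimes> b \<notin> A}\<close>, so its existence is decided by Hall's marriage theorem. For \<open>S \<subseteq> A\<close>,
  let \<open>U\<close> be the set of those \<open>b \<in> B\<close> that no element of \<open>S\<close> may use; that is, \<open>S <#> U \<subseteq> A\<close>. As
  \<open>\<one> \<notin> B\<close>, the set \<open>insert \<one> U\<close> has \<open>card U + 1\<close> elements, and \<open>S <#> insert \<one> U\<close> still lies
  in \<open>A\<close>. Hall's condition \<open>card S \<le> card (B - U)\<close> therefore follows from the sumset bound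
  \<open>card S + card T \<le> card (S <#> T) + 1\<close> for \<open>T = insert \<one> U\<close>.

  That bound is due to Kemperman for torsion-free groups and is the Cauchy-Davenport theorem for
  groups of prime order. Both are instances of one statement, valid in any group: the bound holds
  as soon as \<open>S <#> T\<close> has fewer elements than every nontrivial finite cyclic subgroup
  (\<open>card_set_mult_ge\<close>). DeVos's proof of it replaces \<open>S, T\<close> by an intersection and a union with
  translates, in such a way that the product set does not grow. In a group of prime order the
  hypothesis is met because the product set lies in \<open>A\<close>, and \<open>card A = card B\<close> is smaller than
  the order of the group, \<open>B\<close> missing the identity.

  For the converse, a nontrivial proper finite subgroup \<open>H\<close> and a point \<open>x \<notin> H\<close> obstruct
  matchings: every element of \<open>H\<close> would have to be matched with \<open>x\<close> when \<open>A = H\<close> and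
  \<open>B = insert x (H - {\<one>})\<close>. Hence in a group with the matching property, a nontrivial element of
  finite order generates the whole group, which leaves only torsion-free groups and cyclic groups
  without proper nontrivial subgroups.
\<close>

section \<open>Hall's marriage theorem\<close>

text \<open>
  This is Rado's proof. If some \<open>N a\<close> contains two points \<open>x\<close> and \<open>y\<close>, one of them can be deleted
  from it without violating Hall's condition: otherwise there are sets \<open>S\<close> and \<open>T\<close> of other
  indices witnessing the two violations, and counting the union and the intersection of the
  corresponding neighbourhoods contradicts Hall's condition for \<open>insert a (S \<union> T)\<close> and \<open>S \<inter> T\<close>.
  Once all \<open>N a\<close> are singletons, Hall's condition for pairs makes them distinct.
\<close>

lemma hall_marriage:
  fixes N :: "'a \<Rightarrow> 'b set"
  assumes "finite A" "\<And>a. a \<in> A \<Longrightarrow> finite (N a)"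
    and "\<And>S. S \<subseteq> A \<Longrightarrow> card S \<le> card (\<Union>(N ` S))"
  shows "\<exists>f. inj_on f A \<and> (\<forall>a\<in>A. f a \<in> N a)"
  using assms
proof (induction "\<Sum>a\<in>A. card (N a)" arbitrary: N rule: less_induct)
  case less
  note finN = less.prems(2) and hall = less.prems(3)
  have ne: "N a \<noteq> {}" if "a \<in> A" for a
    using hall[of "{a}"] that by auto
  show ?case
  proof (cases "\<forall>a\<in>A. \<forall>x\<in>N a. \<forall>y\<in>N a. x = y")
    case True
    define f where "f a = (SOME x. x \<in> N a)" for a
    have f: "f a \<in> N a" if "a \<in> A" for a
      using ne[OF that] by (simp add: f_def some_in_eq)
    have sing: "N a = {f a}" if "a \<in> A" for a
      using True f that by blast
    have "inj_on f A"
    proof (rule inj_onI, rule ccontr)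
      fix a b assume ab: "a \<in> A" "b \<in> A" "f a = f b" "a \<noteq> b"
      then have "\<Union>(N ` {a,b}) = {f a}" using sing by auto
      with hall[of "{a,b}"] ab show False by auto
    qed
    with f show ?thesis by blast
  next
    case False
    then obtain a x y where axy: "a \<in> A" "x \<in> N a" "y \<in> N a" "x \<noteq> y" by blast
    define M where "M z = N(a := N a - {z})" for z
    have finM: "finite (M z b)" if "b \<in> A" for z b
      using finN that axy(1) by (auto simp: M_def)
    have IH: "\<exists>f. inj_on f A \<and> (\<forall>b\<in>A. f b \<in> N b)"
      if z: "z \<in> N a" and hallM: "\<And>S. S \<subseteq> A \<Longrightarrow> card S \<le> card (\<Union>(M z ` S))" for z
    proof -
      have "(\<Sum>b\<in>A. card (M z b)) < (\<Sum>b\<in>A. card (N b))"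
      proof (rule sum_strict_mono_ex1)
        show "finite A" by (fact less.prems(1))
        show "\<forall>b\<in>A. card (M z b) \<le> card (N b)"
          using finN by (auto simp: M_def intro: card_mono)
        show "\<exists>b\<in>A. card (M z b) < card (N b)"
          using axy(1) z finN by (intro bexI[of _ a] psubset_card_mono) (auto simp: M_def)
      qed
      from less.hyps[OF this less.prems(1) finM hallM]
      obtain f where "inj_on f A" "\<forall>b\<in>A. f b \<in> M z b" by blast
      moreover have "M z b \<subseteq> N b" for b by (auto simp: M_def)
      ultimately show ?thesis by blast
    qed
    \<comment> \<open>A violating set contains \<open>a\<close>, since the other neighbourhoods are unchanged; \<open>S\<close> is what
       remains of it.\<close>
    have violation: "\<exists>S \<subseteq> A - {a}. card ((N a - {z}) \<union> \<Union>(N ` S)) \<le> card S"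
      if "\<not> (\<forall>S \<subseteq> A. card S \<le> card (\<Union>(M z ` S)))" for z
    proof -
      from that obtain S where S: "S \<subseteq> A" "card (\<Union>(M z ` S)) < card S"
        by (auto simp: not_le)
      have "a \<in> S"
      proof (rule ccontr)
        assume "a \<notin> S"
        then have "\<Union>(M z ` S) = \<Union>(N ` S)" by (auto simp: M_def split: if_splits)
        with S hall[of S] show False by simp
      qed
      have "\<Union>(M z ` S) = (N a - {z}) \<union> \<Union>(N ` (S - {a}))"
        using \<open>a \<in> S\<close> by (auto simp: M_def split: if_splits)
      moreover have "card S = Suc (card (S - {a}))"
        using \<open>a \<in> S\<close> S(1) less.prems(1) by (metis card.remove finite_subset)
      ultimately show ?thesis
        using S by (intro exI[of _ "S - {a}"]) auto
    qed
    have "(\<forall>S \<subseteq> A. card S \<le> card (\<Union>(M x ` S))) \<or> (\<forall>S \<subseteq> A. card S \<le> card (\<Union>(M y ` S)))"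
    proof (rule ccontr)
      assume "\<not> ?thesis"
      then obtain S T where S: "S \<subseteq> A - {a}" "card ((N a - {x}) \<union> \<Union>(N ` S)) \<le> card S"
        and T: "T \<subseteq> A - {a}" "card ((N a - {y}) \<union> \<Union>(N ` T)) \<le> card T"
        using violation by meson
      define P Q where "P = (N a - {x}) \<union> \<Union>(N ` S)" and "Q = (N a - {y}) \<union> \<Union>(N ` T)"
      have fin: "finite S" "finite T" "finite P" "finite Q"
        using S(1) T(1) less.prems(1) finN axy(1)
        by (auto simp: P_def Q_def intro!: finite_Union intro: finite_subset)
      have "P \<union> Q = \<Union>(N ` insert a (S \<union> T))"
        using axy by (auto simp: P_def Q_def)
      moreover have "insert a (S \<union> T) \<subseteq> A" using S(1) T(1) axy(1) by blast
      ultimately have "card (insert a (S \<union> T)) \<le> card (P \<union> Q)"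
        using hall by metis
      moreover have "card (insert a (S \<union> T)) = Suc (card (S \<union> T))"
        using S(1) T(1) fin by (subst card_insert_disjoint) auto
      moreover have "card (S \<inter> T) \<le> card (P \<inter> Q)"
      proof -
        have "card (S \<inter> T) \<le> card (\<Union>(N ` (S \<inter> T)))" using S(1) by (intro hall) auto
        also have "\<dots> \<le> card (P \<inter> Q)"
          using fin by (intro card_mono) (auto simp: P_def Q_def)
        finally show ?thesis .
      qed
      moreover have "card (S \<union> T) + card (S \<inter> T) = card S + card T"
        using card_Un_Int fin by metis
      moreover have "card (P \<union> Q) + card (P \<inter> Q) = card P + card Q"
        using card_Un_Int fin by metis
      ultimately show False using S(2) T(2) by (simp add: P_def Q_def)
    qed
    then show ?thesis using IH axy by blast
  qed
qed

section \<open>The size of product sets\<close>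

context group
begin

lemma card_r_coset: "A \<subseteq> carrier G \<Longrightarrow> g \<in> carrier G \<Longrightarrow> card (A #> g) = card A"
  unfolding r_coset_def
  by (subst UNION_singleton_eq_range) (rule card_image, meson inj_onI r_cancel subsetD)

lemma card_l_coset: "A \<subseteq> carrier G \<Longrightarrow> g \<in> carrier G \<Longrightarrow> card (g <# A) = card A"
  unfolding l_coset_def
  by (subst UNION_singleton_eq_range) (rule card_image, meson inj_onI l_cancel subsetD)

lemma finite_set_mult: "finite A \<Longrightarrow> finite B \<Longrightarrow> finite (A <#> B)"
  by (simp add: set_mult_def)

lemma card_set_mult_ge_left:
  assumes "finite A" "finite B" "A \<subseteq> carrier G" "B \<subseteq> carrier G" "B \<noteq> {}"
  shows "card A \<le> card (A <#> B)"
proof -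
  obtain b where b: "b \<in> B" using assms by blast
  then have "A #> b \<subseteq> A <#> B" by (auto simp: r_coset_def set_mult_def)
  then have "card (A #> b) \<le> card (A <#> B)"
    using assms by (intro card_mono finite_set_mult)
  then show ?thesis using assms b by (simp add: card_r_coset subsetD)
qed

lemma card_set_mult_ge_right:
  assumes "finite A" "finite B" "A \<subseteq> carrier G" "B \<subseteq> carrier G" "A \<noteq> {}"
  shows "card B \<le> card (A <#> B)"
proof -
  obtain a where a: "a \<in> A" using assms by blast
  then have "a <# B \<subseteq> A <#> B" by (auto simp: l_coset_def set_mult_def)
  then have "card (a <# B) \<le> card (A <#> B)"
    using assms by (intro card_mono finite_set_mult)
  then show ?thesis using assms a by (simp add: card_l_coset subsetD)
qed

lemma card_inv_image: "A \<subseteq> carrier G \<Longrightarrow> card (m_inv G ` A) = card A"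
  by (rule card_image) (meson inj_onI inv_inj inj_on_subset inj_onD)

lemma set_mult_inv_image:
  "A \<subseteq> carrier G \<Longrightarrow> B \<subseteq> carrier G \<Longrightarrow> m_inv G ` B <#> m_inv G ` A = m_inv G ` (A <#> B)"
  by (force simp: set_mult_def image_iff inv_mult_group subset_iff)

text \<open>
  A finite set stable under right translation by \<open>g\<close> contains, with \<open>a\<close>, all \<open>a \<otimes> g [^] n\<close>; by
  the pigeonhole principle two of the first \<open>card A + 1\<close> of these coincide.
\<close>

lemma ord_le_card_if_r_coset_eq:
  assumes "finite A" "A \<noteq> {}" "A \<subseteq> carrier G" "g \<in> carrier G" "A #> g = A"
  shows "ord g \<noteq> 0 \<and> ord g \<le> card A"
proof -
  obtain a where a: "a \<in> A" using assms by blast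
  have aG: "a \<in> carrier G" using a assms by blast
  have step: "x \<otimes> g \<in> A" if "x \<in> A" for x
    using that assms(5) by (auto simp: r_coset_def)
  have mem: "a \<otimes> g [^] n \<in> A" for n :: nat
  proof (induction n)
    case 0 then show ?case using a aG by simp
  next
    case (Suc n)
    then show ?case using step[of "a \<otimes> g [^] n"] aG assms(4) by (simp add: m_assoc)
  qed
  have "\<not> inj_on (\<lambda>n::nat. a \<otimes> g [^] n) {..card A}"
    using card_inj_on_le[of "\<lambda>n::nat. a \<otimes> g [^] n" "{..card A}" A] mem assms(1) by auto
  then obtain i j :: nat where "i \<le> card A" "j \<le> card A" "i \<noteq> j" "a \<otimes> g [^] i = a \<otimes> g [^] j"
    by (auto simp: inj_on_def)
  then obtain i j :: nat where ij: "i < j" "j \<le> card A" "a \<otimes> g [^] i = a \<otimes> g [^] j"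
    by (metis linorder_neqE_nat)
  have "g [^] i \<otimes> g [^] (j - i) = g [^] j"
    using ij(1) assms(4) by (simp add: nat_pow_mult)
  also have "\<dots> = g [^] i \<otimes> \<one>"
    using ij(3) aG assms(4) by simp
  finally have "g [^] (j - i) = \<one>"
    using assms(4) l_cancel by blast
  then have "ord g dvd j - i" using assms(4) pow_eq_id by blast
  moreover have "0 < j - i" "j - i \<le> card A" using ij by auto
  ultimately show ?thesis by (metis dvd_0_left dvd_imp_le le_trans not_gr0)
qed

text \<open>
  The two product sets below are the reason for the transformed pairs in the proof of
  \<open>card_set_mult_ge\<close>: a factor \<open>g\<close> on the right of \<open>S\<close> cancels against a factor \<open>inv g\<close> on the
  left of \<open>T\<close>. The element taken from the intersection can be written with or without this extra
  factor, as the one taken from the union requires.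
\<close>

lemma set_mult_transform_subset:
  assumes "S \<subseteq> carrier G" "T \<subseteq> carrier G" "g \<in> carrier G"
  shows "(S \<inter> (S #> g)) <#> (T \<union> (inv g <# T)) \<subseteq> S <#> T"
    and "(S \<union> (S #> g)) <#> (T \<inter> (inv g <# T)) \<subseteq> S <#> T"
proof -
  have cancel: "(s \<otimes> g) \<otimes> (inv g \<otimes> t) = s \<otimes> t" if "s \<in> S" "t \<in> T" for s t
  proof -
    have "s \<in> carrier G" "t \<in> carrier G" using that assms by auto
    then show ?thesis using assms(3) by (metis inv_closed inv_solve_left m_assoc m_closed)
  qed
  then have *: "s \<otimes> t \<in> S <#> T" if "s \<in> S #> g" "t \<in> inv g <# T" for s t
    using that by (fastforce simp: set_mult_def r_coset_def l_coset_def)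
  have **: "s \<otimes> t \<in> S <#> T" if "s \<in> S" "t \<in> T" for s t
    using that by (auto simp: set_mult_def)
  show "(S \<inter> (S #> g)) <#> (T \<union> (inv g <# T)) \<subseteq> S <#> T"
    using * ** by (auto simp: set_mult_def[of G "_ \<inter> _"])
  show "(S \<union> (S #> g)) <#> (T \<inter> (inv g <# T)) \<subseteq> S <#> T"
    using * ** by (auto simp: set_mult_def[of G "_ \<union> _"])
qed

text \<open>
  The induction is on the deficit \<open>2 * card (S <#> T) - (card S + card T)\<close>, then on \<open>card S\<close>.
  Passing to inverses exchanges the roles of \<open>S\<close> and \<open>T\<close>, so \<open>card S \<le> card T\<close> may be assumed;
  and \<open>S\<close> may be assumed to contain distinct points \<open>a\<close> and \<open>b\<close>. For \<open>g = inv b \<otimes> a\<close>, the sets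
  \<open>S\<close> and \<open>S #> g\<close> meet but are different, as \<open>ord g\<close> is too large for \<open>S\<close> to be
  stable under \<open>g\<close>. The cardinalities in the two transformed pairs add up to
  \<open>2 * (card S + card T)\<close>. So either the first pair has no smaller total size than \<open>(S, T)\<close>, while
  its first component is smaller than \<open>S\<close>, or the second pair has a larger total size. In either
  case the product set has not grown, and the induction hypothesis yields a bound at least as good.
\<close>

theorem card_set_mult_ge:
  assumes "finite S" "finite T" "S \<noteq> {}" "T \<noteq> {}" "S \<subseteq> carrier G" "T \<subseteq> carrier G"
    and "\<And>g. g \<in> carrier G \<Longrightarrow> g \<noteq> \<one> \<Longrightarrow> ord g = 0 \<or> card (S <#> T) < ord g"
  shows "card S + card T \<le> card (S <#> T) + 1"
  using assms
proof (induction "(S, T)" arbitrary: S T rule: wf_induct_rule[OF wf_measures[of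
      "[\<lambda>(S, T). 2 * card (S <#> T) - (card S + card T), \<lambda>(S, T). card S]"]])
  case (1 S T)
  note IH = "1.hyps" and fin = "1.prems"(1,2) and ne = "1.prems"(3,4)
    and sub = "1.prems"(5,6) and large = "1.prems"(7)
  have finST: "finite (S <#> T)" using fin by (rule finite_set_mult)
  have sum_le: "card S' + card T' \<le> 2 * card (S' <#> T')"
    if "finite S'" "finite T'" "S' \<noteq> {}" "T' \<noteq> {}" "S' \<subseteq> carrier G" "T' \<subseteq> carrier G" for S' T'
    using card_set_mult_ge_left[of S' T'] card_set_mult_ge_right[of S' T'] that by simp
  have IH': "card S' + card T' \<le> card (S' <#> T') + 1"
    if "finite S'" "finite T'" "S' \<noteq> {}" "T' \<noteq> {}" "S' \<subseteq> carrier G" "T' \<subseteq> carrier G"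
      and le: "card (S' <#> T') \<le> card (S <#> T)"
      and decr: "card S + card T < card S' + card T' \<or>
             card S + card T \<le> card S' + card T' \<and> card S' < card S" for S' T'
  proof (rule IH)
    show "((S', T'), (S, T)) \<in> measures
        [\<lambda>(S, T). 2 * card (S <#> T) - (card S + card T), \<lambda>(S, T). card S]"
      unfolding in_measures prod.case using le decr sum_le[OF that(1-6)] by linarith
    show "ord g = 0 \<or> card (S' <#> T') < ord g" if "g \<in> carrier G" "g \<noteq> \<one>" for g
      using large[OF that] le by linarith
  qed (fact that)+
  show ?case
  proof (cases "card T < card S")
    case True
    have "card (m_inv G ` T) + card (m_inv G ` S)
        \<le> card (m_inv G ` T <#> m_inv G ` S) + 1"
    proof (rule IH')
      show "card (m_inv G ` T <#> m_inv G ` S) \<le> card (S <#> T)"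
        using finST sub by (simp add: set_mult_inv_image card_image_le)
    qed (use fin ne sub True in \<open>auto simp: card_inv_image\<close>)
    moreover have "S <#> T \<subseteq> carrier G" using sub by (rule set_mult_closed)
    ultimately show ?thesis
      using sub by (simp add: set_mult_inv_image card_inv_image)
  next
    case ST: False
    show ?thesis
    proof (cases "card S \<le> 1")
      case True
      then show ?thesis using card_set_mult_ge_right[of S T] fin ne sub by linarith
    next
      case False
      then obtain a b where ab: "a \<in> S" "b \<in> S" "a \<noteq> b"
        by (metis One_nat_def card_le_Suc0_iff_eq fin(1))
      have abG: "a \<in> carrier G" "b \<in> carrier G" using ab sub by auto
      define g where "g = inv b \<otimes> a"
      have g: "g \<in> carrier G" "g \<noteq> \<one>" "b \<otimes> g = a"
        using ab abG inv_solve_left[of \<one> b a] by (auto simp: g_def m_assoc[symmetric])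
      have meet: "a \<in> S #> g" using g(3) ab by (auto simp: r_coset_def)
      have "S #> g \<noteq> S"
      proof
        assume "S #> g = S"
        with fin(1) ne(1) sub(1) g(1) have "ord g \<noteq> 0 \<and> ord g \<le> card S"
          by (rule ord_le_card_if_r_coset_eq)
        moreover have "card S \<le> card (S <#> T)"
          using fin sub ne(2) by (rule card_set_mult_ge_left)
        ultimately show False using large[OF g(1,2)] by linarith
      qed
      have finc: "finite (S #> g)" "finite (inv g <# T)"
        using fin by (auto simp: r_coset_def l_coset_def)
      have subc: "S #> g \<subseteq> carrier G" "inv g <# T \<subseteq> carrier G"
        using sub g by (auto simp: r_coset_def l_coset_def)
      have cardc: "card (S #> g) = card S" "card (inv g <# T) = card T"
        using sub g by (simp_all add: card_r_coset card_l_coset)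
      define S1 T1 S2 T2 where "S1 = S \<inter> (S #> g)" and "T1 = T \<union> (inv g <# T)"
        and "S2 = S \<union> (S #> g)" and "T2 = T \<inter> (inv g <# T)"
      have prods: "S1 <#> T1 \<subseteq> S <#> T" "S2 <#> T2 \<subseteq> S <#> T"
        using set_mult_transform_subset[OF sub g(1)] by (auto simp: S1_def T1_def S2_def T2_def)
      have le: "card (S1 <#> T1) \<le> card (S <#> T)" "card (S2 <#> T2) \<le> card (S <#> T)"
        using prods finST by (auto intro: card_mono)
      have sumS: "card S1 + card S2 = 2 * card S"
        using card_Un_Int[OF fin(1) finc(1)] cardc by (simp add: S1_def S2_def)
      have sumT: "card T1 + card T2 = 2 * card T"
        using card_Un_Int[OF fin(2) finc(2)] cardc by (simp add: T1_def T2_def)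
      have "S1 \<noteq> S"
        using \<open>S #> g \<noteq> S\<close> cardc(1) finc(1) card_subset_eq[of "S #> g" S] by (auto simp: S1_def)
      then have S1: "card S1 < card S"
        using fin by (intro psubset_card_mono) (auto simp: S1_def)
      show ?thesis
      proof (cases "card S + card T \<le> card S1 + card T1")
        case True
        have "card S1 + card T1 \<le> card (S1 <#> T1) + 1"
          by (rule IH') (use fin finc ne sub subc ab meet le S1 True in
              \<open>auto simp: S1_def T1_def\<close>)
        with True le show ?thesis by linarith
      next
        case False
        \<comment> \<open>If \<open>T2\<close> were empty then \<open>card T1 = 2 * card T\<close>, and \<open>card S \<le> card T\<close> would lead to
           the previous case.\<close>
        have "T2 \<noteq> {}" using sumT False ST by auto
        have "card S2 + card T2 \<le> card (S2 <#> T2) + 1"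
          by (rule IH') (use fin finc ne sub subc le False sumS sumT \<open>T2 \<noteq> {}\<close> in
              \<open>auto simp: S2_def T2_def\<close>)
        with False le sumS sumT show ?thesis by linarith
      qed
    qed
  qed
qed

section \<open>Matchings\<close>

text \<open>
  Hall's condition, rephrased with \<open>T = insert \<one> {b \<in> B. \<forall>a\<in>S. a \<otimes> b \<in> A}\<close>, is the lower bound
  on \<open>card (S <#> T)\<close>; the size hypothesis on \<open>A\<close> applies because \<open>S <#> T \<subseteq> A\<close>.
\<close>

lemma matching_exists:
  assumes "finite A" "finite B" "A \<subseteq> carrier G" "B \<subseteq> carrier G" "card A = card B" "\<one> \<notin> B"
    and large: "\<And>g. g \<in> carrier G \<Longrightarrow> g \<noteq> \<one> \<Longrightarrow> ord g = 0 \<or> card A < ord g"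
  shows "\<exists>\<phi>. is_matching G A B \<phi>"
proof -
  define N where "N a = {b \<in> B. a \<otimes> b \<notin> A}" for a
  have "\<exists>\<phi>. inj_on \<phi> A \<and> (\<forall>a\<in>A. \<phi> a \<in> N a)"
  proof (rule hall_marriage)
    fix S assume S: "S \<subseteq> A"
    show "card S \<le> card (\<Union>(N ` S))"
    proof (cases "S = {}")
      case False
      define U where "U = {b \<in> B. \<forall>a\<in>S. a \<otimes> b \<in> A}"
      have U: "U \<subseteq> B" "finite U" "\<one> \<notin> U" using assms by (auto simp: U_def)
      have "S <#> insert \<one> U \<subseteq> A"
        using S assms(3) by (auto simp: set_mult_def U_def subset_iff)
      then have le: "card (S <#> insert \<one> U) \<le> card A"
        using assms(1) by (rule card_mono[rotated])
      have "card S + card (insert \<one> U) \<le> card (S <#> insert \<one> U) + 1"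
      proof (rule card_set_mult_ge)
        show "ord g = 0 \<or> card (S <#> insert \<one> U) < ord g" if "g \<in> carrier G" "g \<noteq> \<one>" for g
          using large[OF that] le by linarith
      qed (use S U False assms in \<open>auto intro: finite_subset\<close>)
      then have "card S + card U \<le> card B" using le U assms(5) by simp
      moreover have "\<Union>(N ` S) = B - U" by (auto simp: N_def U_def)
      ultimately show ?thesis using U by (simp add: card_Diff_subset)
    qed simp
  qed (use assms in \<open>auto simp: N_def\<close>)
  then obtain \<phi> where \<phi>: "inj_on \<phi> A" "\<forall>a\<in>A. \<phi> a \<in> N a" by blast
  then have "\<phi> ` A \<subseteq> B" by (auto simp: N_def)
  then have "\<phi> ` A = B" using \<phi>(1) assms by (simp add: card_image card_subset_eq)
  with \<phi> show ?thesis by (auto simp: is_matching_def bij_betw_def N_def)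
qed

lemma matching_property_finite_subgroup:
  assumes "matching_property G" "subgroup H G" "finite H" "H \<noteq> {\<one>}"
  shows "H = carrier G"
proof (rule ccontr)
  assume "H \<noteq> carrier G"
  then obtain x where x: "x \<in> carrier G" "x \<notin> H"
    using assms(2) subgroup.subset by blast
  define B where "B = insert x (H - {\<one>})"
  have one: "\<one> \<in> H" using assms(2) by (rule subgroup.one_closed)
  have "card H = card B"
    using x(2) card_Suc_Diff1[OF assms(3) one] assms(3) by (simp add: B_def)
  then obtain \<phi> where \<phi>: "bij_betw \<phi> H B" "\<And>h. h \<in> H \<Longrightarrow> h \<otimes> \<phi> h \<notin> H"
    using assms x one subgroup.subset[OF assms(2)]
    unfolding matching_property_def is_matching_def
    by (elim allE[of _ H] allE[of _ B]) (auto simp: B_def)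
  have "\<phi> h = x" if "h \<in> H" for h
  proof -
    have "\<phi> h \<in> B" using \<phi>(1) that by (auto simp: bij_betw_def)
    moreover have "\<phi> h \<notin> H" using \<phi>(2)[OF that] that subgroup.m_closed[OF assms(2)] by blast
    ultimately show ?thesis by (auto simp: B_def)
  qed
  then have "h = \<one>" if "h \<in> H" for h
    using \<phi>(1) one that by (auto simp: bij_betw_def inj_on_def)
  with one assms(4) show False by blast
qed

lemma matching_property_generate_eq_carrier:
  assumes "matching_property G" "g \<in> carrier G" "g \<noteq> \<one>" "ord g \<noteq> 0"
  shows "generate G {g} = carrier G"
proof (rule matching_property_finite_subgroup)
  show "subgroup (generate G {g}) G" using assms(2) by (simp add: generate_is_subgroup)
  show "finite (generate G {g})"
    using assms(2,4) generate_pow_card[of g] by (metis card.infinite)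
  show "generate G {g} \<noteq> {\<one>}"
    using assms(3) generate.incl[of g "{g}" G] by auto
qed (fact assms(1))

text \<open>
  All nontrivial elements of finite order have order \<open>order G\<close>, as each generates \<open>G\<close>. A power of
  \<open>g\<close> of prime order \<open>p\<close>, which exists for any prime \<open>p\<close> dividing \<open>ord g\<close>, is such an element.
\<close>

lemma matching_property_imp_cyclic_prime:
  assumes "matching_property G" "\<not> torsion_free_group G"
  shows "cyclic_group G \<and> Factorial_Ring.prime (order G)"
proof -
  obtain g where g: "g \<in> carrier G" "ord g \<noteq> 0" "g \<noteq> \<one>"
    using assms(2) by (auto simp: torsion_free_group_def)
  have gen: "generate G {h} = carrier G" "ord h = order G"
    if "h \<in> carrier G" "h \<noteq> \<one>" "ord h \<noteq> 0" for h
    using matching_property_generate_eq_carrier[OF assms(1) that] generate_pow_card[OF that(1)]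
    by (simp_all add: order_def)
  have "cyclic_group G"
    using gen(1)[OF g(1,3,2)] generate_pow[OF g(1)] g(1)
    by (auto simp: cyclic_group full_SetCompr_eq)
  moreover have "Factorial_Ring.prime (order G)"
  proof -
    have "ord g \<noteq> 1" using g ord_eq_1 by blast
    then obtain p where p: "Factorial_Ring.prime p" "p dvd ord g"
      using prime_factor_nat by blast
    then obtain k where k: "ord g = k * p" by (metis dvdE mult.commute)
    with g have "ord (g [^] k) = p" by (simp add: ord_pow)
    moreover from this p have "g [^] k \<noteq> \<one>" "ord (g [^] k) \<noteq> 0"
      by (auto simp: ord_id)
    ultimately show ?thesis using gen(2)[of "g [^] k"] g p by simp
  qed
  ultimately show ?thesis ..
qed

end

theorem theorem3p3:
  fixes G :: "('a, 'b) monoid_scheme"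
  assumes "group G"
  shows "matching_property G \<longleftrightarrow>
    torsion_free_group G \<or> (cyclic_group G \<and> Factorial_Ring.prime (order G))"
proof -
  interpret group G by fact
  have "matching_property G" if H: "torsion_free_group G \<or> Factorial_Ring.prime (order G)"
    unfolding matching_property_def
  proof (intro allI impI, elim conjE, rule matching_exists)
    fix A B g
    assume AB: "finite A" "finite B" "A \<subseteq> carrier G" "B \<subseteq> carrier G" "card A = card B" "\<one>\<^bsub>G\<^esub> \<notin> B"
      and g: "g \<in> carrier G" "g \<noteq> \<one>\<^bsub>G\<^esub>"
    from H show "ord g = 0 \<or> card A < ord g"
    proof
      assume "torsion_free_group G"
      then show ?thesis using g by (auto simp: torsion_free_group_def)
    next
      assume p: "Factorial_Ring.prime (order G)"
      then have "finite (carrier G)"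
        by (metis order_gt_0_iff_finite prime_gt_0_nat)
      moreover have "B \<subset> carrier G" using AB by auto
      ultimately have "card A < order G"
        using AB by (simp add: order_def psubset_card_mono)
      moreover have "ord g = order G"
        using p g ord_dvd_group_order[OF g(1)] ord_eq_1[OF g(1)] by (auto simp: prime_nat_iff)
      ultimately show ?thesis by simp
    qed
  qed
  then show ?thesis using matching_property_imp_cyclic_prime by blast
qed

end
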